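(* Let $0<\alpha<4\beta<\infty$ and $\lambda\in\left(0,2-\frac{\alpha}{2\beta}\right)$. Let $H$ be a real Hilbert space, let $A\colon H\rightrightarrows H$ and $B\colon H\rightrightarrows H$ be monotone, and let $C\colon H\rightrightarrows H$ be $\beta$-cocoercive. (1) If $A$ is $L_A$-Lipschitz and $B$ is $\mu_B$-strongly monotone with $L_A,\mu_B\in(0,\infty)$, then $T_{A,B,C,\alpha,\lambda}$ is $\rho$-contractive with $$\rho=\sqrt{1-\min\left\{\frac{2\alpha\mu_B\lambda(2-\lambda)}{(1+\alpha^2L_A^2)(2-\lambda+2\alpha\mu_B)},\ \frac{2\alpha\lambda\bigl((2-\lambda)(\mu_B+L_A)+2\alpha\mu_BL_A\bigr)}{(1+\alpha L_A)^2(2-\lambda+2\alpha\mu_B)}\right\}}.$$ (2) Symmetrically, if $A$ is $\mu_A$-strongly monotone and $B$ is $L_B$-Lipschitz with $\mu_A,L_B\in(0,\infty)$, then $T_{A,B,C,\alpha,\lambda}$ is $\rho$-contractive with $$\rho=\sqrt{1-\min\left\{\frac{2\alpha\mu_A\lambda(2-\lambda)}{(1+\alpha^2L_B^2)(2-\lambda+2\alpha\mu_A)},\ \frac{2\alpha\lambda\bigl((2-\lambda)(\mu_A+L_B)+2\alpha\mu_AL_B\bigr)}{(1+\alpha L_B)^2(2-\lambda+2\alpha\mu_A)}\right\}}.$$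
   Context: A (multi-valued) operator $A\colon H\rightrightarrows H$ is identified with its graph, a subset of $H\times H$; $u\in Ax$ means $(x,u)\in A$, and $\mathrm{dom}\,A=\{x:Ax\ne\emptyset\}$. Operators need not have full domain and monotone operators need not be maximal. Set $A^{-1}=\{(u,x):(x,u)\in A\}$, $A+B=\{(x,u+v):(x,u)\in A,(x,v)\in B\}$, $AB=\{(x,s):\exists u,\ (x,u)\in B,\ (u,s)\in A\}$, $I$ the identity, and $J_{\alpha A}=(I+\alpha A)^{-1}$ the resolvent. For all $u\in Ax$, $v\in Ay$: $A$ is monotone if $\langle x-y,u-v\rangle\ge0$; $\mu$-strongly monotone if $\langle x-y,u-v\rangle\ge\mu\|x-y\|^2$; $L$-Lipschitz if $\|u-v\|\le L\|x-y\|$; $\beta$-cocoercive if $\langle x-y,u-v\rangle\ge\beta\|u-v\|^2$. (Lipschitz and cocoercive operators, and resolvents of monotone operators, are single-valued on their domains.) The (averaged) Davis–Yin splitting operator with stepsize $\alpha$ and averaging parameter $\lambda$ is $$T_{A,B,C,\alpha,\lambda}=I-\lambda J_{\alpha B}+\lambda J_{\alpha A}(2J_{\alpha B}-I-\alpha CJ_{\alpha B}),$$ which under the present assumptions is single-valued on its domain. A single-valued operator $T$ is $\rho$-contractive if $\|Tx-Ty\|\le\rho\|x-y\|$ for all $x,y\in\mathrm{dom}\,T$. *)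

theory Defs
  imports "HOL-Analysis.Analysis"
begin

text \<open>
  A multi-valued operator is its graph. The inverse is the relation converse, the identity is
  \<^const>\<open>Id\<close>, and the operator product $AB$ (first $B$, then $A$) is \<open>B O A\<close>, since
  \<^const>\<open>relcomp\<close> composes from left to right.
\<close>

type_synonym 'a multiop = "('a \<times> 'a) set"

definition op_add :: "'a::real_vector multiop \<Rightarrow> 'a multiop \<Rightarrow> 'a multiop"
    (infixl \<open>+\<^sub>o\<close> 65)
  where "A +\<^sub>o B = {(x, u + v) | x u v. (x, u) \<in> A \<and> (x, v) \<in> B}"

definition op_scale :: "real \<Rightarrow> 'a::real_vector multiop \<Rightarrow> 'a multiop"
    (infixr \<open>*\<^sub>o\<close> 76)
  where "c *\<^sub>o A = {(x, c *\<^sub>R u) | x u. (x, u) \<in> A}"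

definition op_diff :: "'a::real_vector multiop \<Rightarrow> 'a multiop \<Rightarrow> 'a multiop"
    (infixl \<open>-\<^sub>o\<close> 65)
  where "A -\<^sub>o B = A +\<^sub>o (-1) *\<^sub>o B"

definition resolvent :: "'a::real_vector multiop \<Rightarrow> 'a multiop"
  where "resolvent A = (Id +\<^sub>o A)\<inverse>"

definition monotone_op :: "'a::real_inner multiop \<Rightarrow> bool"
  where "monotone_op A \<longleftrightarrow>
    (\<forall>x u y v. (x, u) \<in> A \<longrightarrow> (y, v) \<in> A \<longrightarrow> inner (x - y) (u - v) \<ge> 0)"

definition strongly_monotone_op :: "real \<Rightarrow> 'a::real_inner multiop \<Rightarrow> bool"
  where "strongly_monotone_op \<mu> A \<longleftrightarrow>
    (\<forall>x u y v. (x, u) \<in> A \<longrightarrow> (y, v) \<in> A \<longrightarrow>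
      inner (x - y) (u - v) \<ge> \<mu> * (norm (x - y))\<^sup>2)"

definition lipschitz_op :: "real \<Rightarrow> 'a::real_inner multiop \<Rightarrow> bool"
  where "lipschitz_op L A \<longleftrightarrow>
    (\<forall>x u y v. (x, u) \<in> A \<longrightarrow> (y, v) \<in> A \<longrightarrow> norm (u - v) \<le> L * norm (x - y))"

definition cocoercive_op :: "real \<Rightarrow> 'a::real_inner multiop \<Rightarrow> bool"
  where "cocoercive_op \<beta> A \<longleftrightarrow>
    (\<forall>x u y v. (x, u) \<in> A \<longrightarrow> (y, v) \<in> A \<longrightarrow>
      inner (x - y) (u - v) \<ge> \<beta> * (norm (u - v))\<^sup>2)"

definition contractive_op :: "real \<Rightarrow> 'a::real_inner multiop \<Rightarrow> bool"
  where "contractive_op \<rho> T \<longleftrightarrow> single_valued T \<and>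
    (\<forall>x u y v. (x, u) \<in> T \<longrightarrow> (y, v) \<in> T \<longrightarrow> norm (u - v) \<le> \<rho> * norm (x - y))"

definition davis_yin ::
    "'a::real_inner multiop \<Rightarrow> 'a multiop \<Rightarrow> 'a multiop \<Rightarrow> real \<Rightarrow> real \<Rightarrow> 'a multiop"
  where "davis_yin A B C \<alpha> lam =
    (let JA = resolvent (\<alpha> *\<^sub>o A); JB = resolvent (\<alpha> *\<^sub>o B) in
      Id -\<^sub>o lam *\<^sub>o JB
         +\<^sub>o lam *\<^sub>o ((2 *\<^sub>o JB -\<^sub>o Id -\<^sub>o \<alpha> *\<^sub>o (JB O C)) O JA))"

end

theory Submission
  imports Defs
begin

text \<open>
  Let $b$, $a$ be the increments of $J_{\alpha B}$ and of the outer $J_{\alpha A}$ between two points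
  with difference $z$, let $\alpha B$, $\alpha A$, $\alpha C$ have increments $u$, $v$, $c$ there, and put
  $\theta = 2 - \lambda$, so that $z = b + u$ and $w := 2b - z - c = a + v$. The operator has increment
  $z - \lambda (b - a)$, so its squared norm drops by $\lambda N$ with
  $N = 2\langle b - a, z\rangle - \lambda |b - a|^2$, and one needs $N \ge r |z|^2$.
  Cocoercivity of $C$ enters only as $|c|^2 \le 2\theta\langle b, c\rangle$.

  With $m = 2\alpha\mu$ and $q = \theta m / (\theta + m)$, strong monotonicity of $A$ gives
  $N \ge q |b|^2 + 2\langle b, u\rangle$ by completing a square in $a$, while strong monotonicity
  of $B$ gives $N |w|^2 \ge (q |a|^2 + 2\langle a, v\rangle) |z|^2$.
  In both cases the remaining operator is monotone and Lipschitz; for a vector $a$ and its image $v$ with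
  $|v| \le l |a|$ the quotient of $q |a|^2 + 2\langle a, v\rangle$ by $|a + v|^2$ is least at
  $\langle a, v\rangle = 0$ or at $v = l a$. These are the two terms of the minimum.
\<close>

section \<open>Resolvents and the points of the Davis-Yin graph\<close>

lemma resolvent_step:
  assumes "(z, b) \<in> resolvent (\<alpha> *\<^sub>o B)"
  obtains p where "(b, p) \<in> B" "z = b + \<alpha> *\<^sub>R p"
  using assms by (auto simp: resolvent_def op_add_def op_scale_def)

lemma resolvent_unique:
  assumes "monotone_op B" "0 \<le> \<alpha>"
    and "(z, b) \<in> resolvent (\<alpha> *\<^sub>o B)" "(z, b') \<in> resolvent (\<alpha> *\<^sub>o B)"
  shows "b = b'"
proof -
  obtain p where p: "(b, p) \<in> B" "z = b + \<alpha> *\<^sub>R p"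
    using assms(3) by (rule resolvent_step)
  obtain p' where p': "(b', p') \<in> B" "z = b' + \<alpha> *\<^sub>R p'"
    using assms(4) by (rule resolvent_step)
  have "b - b' = - (\<alpha> *\<^sub>R (p - p'))"
    using p(2) p'(2) by (simp add: algebra_simps)
  then have "inner (b - b') (b - b') = - (\<alpha> * inner (b - b') (p - p'))"
    by (metis inner_minus_right inner_scaleR_right)
  also have "\<dots> \<le> 0"
    using assms(1,2) p(1) p'(1) by (simp add: monotone_op_def)
  finally show ?thesis
    by (metis inner_eq_zero_iff inner_ge_zero order_antisym eq_iff_diff_eq_0)
qed

lemma davis_yin_step:
  assumes "monotone_op B" "0 \<le> \<alpha>" and T: "(z, t) \<in> davis_yin A B C \<alpha> lam"
  obtains b p c a q where "(b, p) \<in> B" "(b, c) \<in> C" "(a, q) \<in> A"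
    "z = b + \<alpha> *\<^sub>R p" "2 *\<^sub>R b - z - \<alpha> *\<^sub>R c = a + \<alpha> *\<^sub>R q"
    "t = z - lam *\<^sub>R b + lam *\<^sub>R a"
proof -
  obtain b b' b'' c a where J: "(z, b) \<in> resolvent (\<alpha> *\<^sub>o B)"
      "(z, b') \<in> resolvent (\<alpha> *\<^sub>o B)" "(z, b'') \<in> resolvent (\<alpha> *\<^sub>o B)"
    and c: "(b'', c) \<in> C"
    and a: "(2 *\<^sub>R b' - z - \<alpha> *\<^sub>R c, a) \<in> resolvent (\<alpha> *\<^sub>o A)"
    and t: "t = z - lam *\<^sub>R b + lam *\<^sub>R a"
    using T by (auto simp: davis_yin_def Let_def op_add_def op_diff_def op_scale_def)
  \<comment> \<open>The relation chooses a value of the resolvent of B independently at each of its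
    three occurrences; uniqueness merges them into one point \<open>b\<close>.\<close>
  have eq: "b' = b" "b'' = b"
    using J assms(1,2) resolvent_unique by blast+
  obtain p where p: "(b, p) \<in> B" "z = b + \<alpha> *\<^sub>R p"
    using J(1) by (rule resolvent_step)
  obtain q where q: "(a, q) \<in> A" "2 *\<^sub>R b - z - \<alpha> *\<^sub>R c = a + \<alpha> *\<^sub>R q"
    using a unfolding eq by (rule resolvent_step)
  show ?thesis
    using that p q c t unfolding eq by blast
qed

section \<open>The constants q and r\<close>

text \<open>For positive arguments this is the reciprocal of 1/x + 1/y. At \<theta> and m it is the
  largest q with (\<theta> - q)(\<theta> + m) >= \<theta>^2, the relation on which both decrease
  estimates turn; \<open>diff_half_harmonic\<close> is its equality case.\<close>

definition half_harmonic :: "real \<Rightarrow> real \<Rightarrow> real"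
  where "half_harmonic x y = x * y / (x + y)"

lemma half_harmonic_nonneg: "0 < x \<Longrightarrow> 0 < y \<Longrightarrow> 0 \<le> half_harmonic x y"
  by (simp add: half_harmonic_def)

lemma diff_half_harmonic:
  "0 < x \<Longrightarrow> 0 < y \<Longrightarrow> (x - half_harmonic x y) * (x + y) = x\<^sup>2"
  by (simp add: half_harmonic_def field_simps power2_eq_square)

definition rate :: "real \<Rightarrow> real \<Rightarrow> real"
  where "rate q l = min (q / (1 + l\<^sup>2)) ((q + 2 * l) / (1 + l)\<^sup>2)"

lemma rate_nonneg: "0 \<le> q \<Longrightarrow> 0 \<le> l \<Longrightarrow> 0 \<le> rate q l"
  by (simp add: rate_def)

text \<open>Serves the degenerate case \<open>a + v = 0\<close> of \<open>decrease_rate_B\<close>,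
  where one cannot divide by |a + v|^2.\<close>

lemma rate_le:
  assumes "0 \<le> q"
  shows "rate q l \<le> q"
proof -
  have "q / (1 + l\<^sup>2) \<le> q / 1"
    using assms by (intro divide_left_mono) (auto simp: add_pos_nonneg)
  then show ?thesis
    by (simp add: rate_def min_le_iff_disj)
qed

text \<open>Once |u|^2 is replaced by its bound l^2 |a|^2, the gap between the two sides is affine
  in \<open>\<tau>\<close>, which ranges over [0, l |a|^2]. Checking the two ends suffices, and they
  give the two terms of \<open>rate\<close>.\<close>

lemma rate_mult_norm_le:
  fixes a u :: "'a::real_inner"
  assumes q: "0 \<le> q" and l: "0 < l"
    and mono: "0 \<le> inner a u" and lip: "norm u \<le> l * norm a"
  shows "rate q l * inner (a + u) (a + u) \<le> q * inner a a + 2 * inner a u"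
proof -
  define r where "r = rate q l"
  define N where "N = inner a a"
  define \<tau> where "\<tau> = inner a u"
  have N: "0 \<le> N" and r0: "0 \<le> r"
    using q l by (auto simp: N_def r_def rate_nonneg)
  have "0 < 1 + l\<^sup>2" "0 < (1 + l)\<^sup>2"
    using l by (auto simp: add_pos_nonneg)
  moreover have "r \<le> q / (1 + l\<^sup>2)" "r \<le> (q + 2 * l) / (1 + l)\<^sup>2"
    by (auto simp: r_def rate_def)
  ultimately have r: "r * (1 + l\<^sup>2) \<le> q" "r * (1 + l)\<^sup>2 \<le> q + 2 * l"
    by (simp_all add: pos_le_divide_eq)
  have "(norm u)\<^sup>2 \<le> (l * norm a)\<^sup>2"
    using lip by (intro power_mono) auto
  then have uu: "inner u u \<le> l\<^sup>2 * N"
    by (simp add: N_def power_mult_distrib power2_norm_eq_inner)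
  have "\<tau> \<le> norm a * norm u"
    unfolding \<tau>_def by (rule norm_cauchy_schwarz)
  also have "\<dots> \<le> norm a * (l * norm a)"
    using lip by (intro mult_left_mono) auto
  finally have \<tau>: "\<tau> \<le> l * N"
    by (simp add: N_def power2_norm_eq_inner[symmetric] power2_eq_square algebra_simps)
  have "r * inner (a + u) (a + u) = r * (N + 2 * \<tau> + inner u u)"
    by (simp add: N_def \<tau>_def inner_add_left inner_add_right inner_commute)
  also have "\<dots> \<le> r * (N + 2 * \<tau> + l\<^sup>2 * N)"
    using uu r0 by (intro mult_left_mono) auto
  also have "\<dots> \<le> q * N + 2 * \<tau>"
  \<comment> \<open>The gap has slope 2 (1 - r) in \<open>\<tau>\<close>, so the critical end is
    \<open>\<tau>\<close> = 0 for r <= 1 and \<open>\<tau>\<close> = l N otherwise.\<close>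
  proof (cases "r \<le> 1")
    case True
    then have "0 \<le> (1 - r) * \<tau>"
      using mono by (simp add: \<tau>_def)
    moreover have "r * (1 + l\<^sup>2) * N \<le> q * N"
      using r(1) N by (rule mult_right_mono)
    ultimately show ?thesis
      by (simp add: algebra_simps)
  next
    case False
    then have "(r - 1) * \<tau> \<le> (r - 1) * (l * N)"
      using \<tau> by (intro mult_left_mono) auto
    moreover have "r * (1 + l)\<^sup>2 * N \<le> (q + 2 * l) * N"
      using r(2) N by (rule mult_right_mono)
    ultimately show ?thesis
      by (simp add: algebra_simps power2_eq_square)
  qed
  finally show ?thesis
    by (simp add: r_def N_def \<tau>_def)
qed

section \<open>Lower bounds for the decrease N\<close>

lemma decrease_strongly_monotone_A:
  fixes a b c u v :: "'a::real_inner"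
  assumes pos: "0 < \<theta>" "0 < m"
    and A: "m * inner a a \<le> 2 * inner a v"
    and C: "inner c c \<le> 2 * \<theta> * inner b c"
    and w: "b - u - c = a + v"
  defines "z \<equiv> b + u"
  shows "half_harmonic \<theta> m * inner b b + 2 * inner b u
    \<le> 2 * inner (b - a) z - (2 - \<theta>) * inner (b - a) (b - a)"
proof -
  define q where "q = half_harmonic \<theta> m"
  \<comment> \<open>The bound on c says that c lies in the ball of radius \<theta> |b| about
    \<theta> b; \<open>\<xi>\<close> is its offset from the centre.\<close>
  define \<xi> where "\<xi> = c - \<theta> *\<^sub>R b"
  have q: "(\<theta> - q) * (\<theta> + m) = \<theta>\<^sup>2"
    using pos by (simp add: q_def diff_half_harmonic)
  have \<xi>: "inner \<xi> \<xi> \<le> \<theta>\<^sup>2 * inner b b"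
    using C by (simp add: \<xi>_def inner_diff_left inner_diff_right inner_commute power2_eq_square algebra_simps)
  have u: "u = b - c - a - v"
    using w by (simp add: algebra_simps)
  \<comment> \<open>Multiplying by \<theta> + m completes the square in \<open>a\<close> without
    division; the remainder is nonnegative because |\<xi>|^2 <= \<theta>^2 |b|^2.\<close>
  have "(\<theta> + m) * ((m + \<theta>) * inner a a + 2 * inner a \<xi> + (\<theta> - q) * inner b b)
      = inner ((\<theta> + m) *\<^sub>R a + \<xi>) ((\<theta> + m) *\<^sub>R a + \<xi>) - inner \<xi> \<xi> + (\<theta> - q) * (\<theta> + m) * inner b b"
    by (simp add: inner_add_left inner_add_right inner_commute algebra_simps)
  also have "\<dots> \<ge> 0"
    using \<xi> inner_ge_zero[of "(\<theta> + m) *\<^sub>R a + \<xi>"] unfolding q by linarith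
  finally have "0 \<le> (m + \<theta>) * inner a a + 2 * inner a \<xi> + (\<theta> - q) * inner b b"
    using pos by (simp add: zero_le_mult_iff)
  moreover have "2 * inner (b - a) z - (2 - \<theta>) * inner (b - a) (b - a)
      - 2 * inner b u - q * inner b b
      = (m + \<theta>) * inner a a + 2 * inner a \<xi> + (\<theta> - q) * inner b b + (2 * inner a v - m * inner a a)"
    unfolding z_def u \<xi>_def
    by (simp add: inner_add_left inner_add_right inner_diff_left inner_diff_right inner_commute algebra_simps)
  ultimately show ?thesis
    using A unfolding q_def by linarith
qed

text \<open>M is the decrease N at a = 0, and s = z + w. The left side equals \<theta>^2 |b|^2 + (2
  - \<theta>) M plus a term that cocoercivity makes nonpositive. Writing \<theta>^2 as (\<theta> -
  q)(\<theta> + m) and using (\<theta> + m) |b|^2 <= M, which is strong monotonicity of B, gives the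
  claim.\<close>

lemma cocoercive_strongly_monotone_bound:
  fixes b c z :: "'a::real_inner"
  assumes pos: "0 < \<theta>" "0 < m"
    and B: "(2 + m) * inner b b \<le> 2 * inner b z"
    and C: "inner c c \<le> 2 * \<theta> * inner b c"
  defines "s \<equiv> 2 *\<^sub>R b - c" and "M \<equiv> 2 * inner b z - (2 - \<theta>) * inner b b"
  shows "inner s s - 2 * (2 - \<theta>) * inner (s - z) b \<le> (2 - half_harmonic \<theta> m) * M"
proof -
  define q where "q = half_harmonic \<theta> m"
  have q: "(\<theta> - q) * (\<theta> + m) = \<theta>\<^sup>2"
    using pos by (simp add: q_def diff_half_harmonic)
  then have "0 \<le> (\<theta> - q) * (\<theta> + m)"
    by simp
  then have q': "0 \<le> \<theta> - q"
    using pos by (simp add: zero_le_mult_iff)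
  have "inner s s - 2 * (2 - \<theta>) * inner (s - z) b
      = \<theta>\<^sup>2 * inner b b + (2 - \<theta>) * M + (inner c c - 2 * \<theta> * inner b c)"
    by (simp add: s_def M_def inner_diff_left inner_diff_right inner_commute power2_eq_square algebra_simps)
  also have "\<dots> \<le> (\<theta> - q) * ((\<theta> + m) * inner b b) + (2 - \<theta>) * M"
    using C q by (simp flip: mult.assoc)
  also have "\<dots> \<le> (\<theta> - q) * M + (2 - \<theta>) * M"
    using B q' by (intro add_right_mono mult_left_mono) (auto simp: M_def algebra_simps)
  finally show ?thesis
    by (simp add: q_def algebra_simps)
qed

lemma decrease_strongly_monotone_B:
  fixes a b c z :: "'a::real_inner"
  assumes pos: "0 < \<theta>" "0 < m" and \<theta>2: "\<theta> \<le> 2"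
    and B: "(2 + m) * inner b b \<le> 2 * inner b z"
    and C: "inner c c \<le> 2 * \<theta> * inner b c"
  defines "w \<equiv> 2 *\<^sub>R b - z - c"
  shows "(half_harmonic \<theta> m * inner a a + 2 * inner a (w - a)) * inner z z
    \<le> (2 * inner (b - a) z - (2 - \<theta>) * inner (b - a) (b - a)) * inner w w"
proof -
  \<comment> \<open>Right minus left side is the quadratic \<open>K |a|\<^sup>2 - 2 <a, v> + P\<close> in the free vector \<open>a\<close>;
    its discriminant is controlled by the bound on \<open>inner (z + w) (z + w)\<close>.\<close>
  define q where "q = half_harmonic \<theta> m"
  define M where "M = 2 * inner b z - (2 - \<theta>) * inner b b"
  define K where "K = (2 - q) * inner z z - (2 - \<theta>) * inner w w"
  \<comment> \<open>This \<open>v\<close> is the linear coefficient of the quadratic; the increment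
    of \<alpha>A is \<open>w - a\<close> in this lemma.\<close>
  define v where "v = inner z z *\<^sub>R w + inner w w *\<^sub>R (z - (2 - \<theta>) *\<^sub>R b)"
  define P where "P = inner w w * M"
  have q: "(\<theta> - q) * (\<theta> + m) = \<theta>\<^sup>2"
    using pos by (simp add: q_def diff_half_harmonic)
  then have "0 \<le> (\<theta> - q) * (\<theta> + m)"
    by simp
  then have q': "0 \<le> \<theta> - q"
    using pos by (simp add: zero_le_mult_iff)
  have Mb: "(\<theta> + m) * inner b b \<le> M"
    using B by (simp add: M_def algebra_simps)
  then have M0: "0 \<le> M"
    using pos by (smt (verit) inner_ge_zero mult_nonneg_nonneg)
  have quad: "(2 * inner (b - a) z - (2 - \<theta>) * inner (b - a) (b - a)) * inner w w
      - (q * inner a a + 2 * inner a (w - a)) * inner z z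
      = K * inner a a - 2 * inner a v + P"
    by (simp add: K_def v_def P_def M_def inner_add_right inner_diff_left inner_diff_right inner_commute algebra_simps)
  have sw: "2 *\<^sub>R b - c = z + w"
    by (simp add: w_def)
  have H: "inner (z + w) (z + w) - 2 * (2 - \<theta>) * inner w b \<le> (2 - q) * M"
    using cocoercive_strongly_monotone_bound[OF pos B C] by (simp add: sw q_def M_def)
  \<comment> \<open>Since |z - (2 - \<theta>) b|^2 = |z|^2 - (2 - \<theta>) M, the expansion leaves
    as the factor of |z|^2 exactly the quantity bounded in \<open>H\<close>.\<close>
  have "inner v v = inner w w *
      (inner z z * (inner (z + w) (z + w) - 2 * (2 - \<theta>) * inner w b) - (2 - \<theta>) * M * inner w w)"
    by (simp add: v_def M_def inner_add_left inner_add_right inner_diff_left inner_diff_right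
        inner_commute algebra_simps)
  also have "\<dots> \<le> inner w w * (inner z z * ((2 - q) * M) - (2 - \<theta>) * M * inner w w)"
    using H by (intro mult_left_mono diff_right_mono) auto
  also have "\<dots> = P * K"
    by (simp add: P_def K_def algebra_simps)
  finally have disc: "inner v v \<le> P * K" .
  have "0 \<le> K * inner a a - 2 * inner a v + P"
  proof (cases "P = 0")
    case False
    then have P: "0 < P"
      using M0 by (simp add: P_def less_le)
    \<comment> \<open>P times the quadratic dominates this square, by Cauchy-Schwarz and
      \<open>disc\<close>.\<close>
    have "0 \<le> (P - inner a v)\<^sup>2"
      by simp
    also have "\<dots> = P\<^sup>2 - 2 * P * inner a v + (inner a v)\<^sup>2"
      by (simp add: power2_eq_square algebra_simps)
    also have "(inner a v)\<^sup>2 \<le> inner a a * inner v v"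
      by (rule Cauchy_Schwarz_ineq)
    also have "\<dots> \<le> inner a a * (P * K)"
      using disc by (intro mult_left_mono) auto
    finally have "0 \<le> P * (K * inner a a - 2 * inner a v + P)"
      by (simp add: power2_eq_square algebra_simps)
    then show ?thesis
      using P by (simp add: zero_le_mult_iff)
  next
    \<comment> \<open>For P = 0 the discriminant bound yields \<open>v = 0\<close> but leaves the
      sign of \<open>K\<close> open. If w = 0, then K = (2 - q) |z|^2; if b = 0, then c = 0 and w =
      -z, so K = (\<theta> - q) |z|^2.\<close>
    case True
    then have v: "v = 0"
      using disc by (metis inner_eq_zero_iff inner_ge_zero mult_zero_left order_antisym)
    have "inner w w = 0 \<or> inner b b = 0"
    proof -
      have "inner b b = 0" if "M = 0"
        using Mb that pos inner_ge_zero[of b] by (smt (verit) mult_pos_pos)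
      then show ?thesis
        using True by (auto simp: P_def)
    qed
    then have "0 \<le> K"
    proof
      assume "inner w w = 0"
      moreover have "0 \<le> 2 - q"
        using q' \<theta>2 by linarith
      ultimately show ?thesis
        by (simp add: K_def)
    next
      assume "inner b b = 0"
      then have "b = 0"
        by simp
      moreover from this have "c = 0"
        using C by (metis inner_eq_zero_iff inner_ge_zero inner_zero_left mult_zero_right order_antisym)
      ultimately have "w = - z"
        by (simp add: w_def)
      then show ?thesis
        using q' by (simp add: K_def flip: left_diff_distrib)
    qed
    then show ?thesis
      using v True by simp
  qed
  then show ?thesis
    using quad by (simp add: q_def)
qed

text \<open>The rate estimate for a and v, multiplied by |z|^2, is chained with
  \<open>decrease_strongly_monotone_B\<close>; the common factor |a + v|^2 is then cancelled. When
  it vanishes, a direct argument is needed.\<close>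

lemma decrease_rate_B:
  fixes a b c v z :: "'a::real_inner"
  assumes pos: "0 < \<theta>" "0 < m" and \<theta>2: "\<theta> \<le> 2" and l: "0 < l"
    and B: "(2 + m) * inner b b \<le> 2 * inner b z"
    and C: "inner c c \<le> 2 * \<theta> * inner b c"
    and w: "2 *\<^sub>R b - z - c = a + v"
    and A: "0 \<le> inner a v" "norm v \<le> l * norm a"
  shows "rate (half_harmonic \<theta> m) l * inner z z
    \<le> 2 * inner (b - a) z - (2 - \<theta>) * inner (b - a) (b - a)"
proof -
  define q where "q = half_harmonic \<theta> m"
  define r where "r = rate q l"
  define N where "N = 2 * inner (b - a) z - (2 - \<theta>) * inner (b - a) (b - a)"
  have q: "0 \<le> q"
    using pos by (simp add: q_def half_harmonic_nonneg)
  have "r * inner (a + v) (a + v) * inner z z \<le> (q * inner a a + 2 * inner a v) * inner z z"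
    using rate_mult_norm_le[OF q l A] by (intro mult_right_mono) (auto simp: r_def)
  also have "\<dots> \<le> N * inner (a + v) (a + v)"
    using decrease_strongly_monotone_B[OF pos \<theta>2 B C, of a] by (simp add: w q_def N_def)
  finally have main: "r * inner z z * inner (a + v) (a + v) \<le> N * inner (a + v) (a + v)"
    by (simp add: ac_simps)
  show ?thesis
  proof (cases "a + v = 0")
    case False
    then have "r * inner z z \<le> N"
      using main by (simp add: mult_le_cancel_right)
    then show ?thesis
      by (simp add: r_def q_def N_def)
  next
    case True
    then have "v = - a"
      by (simp add: eq_neg_iff_add_eq_0 add.commute)
    \<comment> \<open>Monotonicity of A gives 0 <= <a, v> = -|a|^2.\<close>
    then have a: "a = 0"
      using A(1) by (metis inner_eq_zero_iff inner_ge_zero inner_minus_right neg_0_le_iff_le order_antisym)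
    have z: "z = 2 *\<^sub>R b - c"
      using w True by (simp add: algebra_simps)
    have N: "N = 2 * inner b z - (2 - \<theta>) * inner b b"
      by (simp add: N_def a)
    have "0 \<le> (\<theta> + m) * inner b b"
      using pos by simp
    also have "\<dots> \<le> N"
      using B by (simp add: N algebra_simps)
    finally have N0: "0 \<le> N" .
    \<comment> \<open>Now w = 0, so z is the vector s of the auxiliary bound and its subtracted term
      vanishes.\<close>
    have zz: "inner z z \<le> (2 - q) * N"
      using cocoercive_strongly_monotone_bound[OF pos B C] by (simp add: N q_def flip: z)
    have "r * inner z z \<le> q * inner z z"
      using rate_le[OF q] by (intro mult_right_mono) (auto simp: r_def)
    also have "\<dots> \<le> q * ((2 - q) * N)"
      using zz q by (rule mult_left_mono)
    \<comment> \<open>The point is q (2 - q) <= 1, so the cruder bound r <= q suffices here.\<close>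
    also have "\<dots> = N - (1 - q)\<^sup>2 * N"
      by (simp add: power2_eq_square algebra_simps)
    also have "\<dots> \<le> N"
      using N0 by simp
    finally show ?thesis
      by (simp add: r_def q_def N_def)
  qed
qed

text \<open>The rate estimate is applied to b and u, whose sum is z itself, so it chains with the
  decrease bound without any cancellation.\<close>

lemma decrease_rate_A:
  fixes a b c u v z :: "'a::real_inner"
  assumes pos: "0 < \<theta>" "0 < m" and l: "0 < l"
    and A: "m * inner a a \<le> 2 * inner a v"
    and C: "inner c c \<le> 2 * \<theta> * inner b c"
    and w: "b - u - c = a + v"
    and B: "0 \<le> inner b u" "norm u \<le> l * norm b"
  shows "rate (half_harmonic \<theta> m) l * inner (b + u) (b + u)
    \<le> 2 * inner (b - a) (b + u) - (2 - \<theta>) * inner (b - a) (b - a)"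
  using rate_mult_norm_le[OF half_harmonic_nonneg[OF pos] l B]
    decrease_strongly_monotone_A[OF pos A C w] by linarith

section \<open>Operator hypotheses as inequalities between increments\<close>

definition increments :: "real \<Rightarrow> 'a::real_inner multiop \<Rightarrow> 'a multiop"
  where "increments \<alpha> A = {(x - y, \<alpha> *\<^sub>R (u - v)) | x y u v. (x, u) \<in> A \<and> (y, v) \<in> A}"

lemma increments_monotone:
  "monotone_op A \<Longrightarrow> 0 \<le> \<alpha> \<Longrightarrow> (a, v) \<in> increments \<alpha> A \<Longrightarrow> 0 \<le> inner a v"
  by (auto simp: increments_def monotone_op_def)

lemma increments_strongly_monotone:
  assumes "strongly_monotone_op \<mu> A" "0 \<le> \<alpha>" "(a, v) \<in> increments \<alpha> A"
  shows "2 * \<alpha> * \<mu> * inner a a \<le> 2 * inner a v"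
proof -
  obtain x y p q where *: "a = x - y" "v = \<alpha> *\<^sub>R (p - q)" "(x, p) \<in> A" "(y, q) \<in> A"
    using assms(3) by (auto simp: increments_def)
  have "\<mu> * inner a a \<le> inner a (p - q)"
    using assms(1) * by (auto simp: strongly_monotone_op_def power2_norm_eq_inner)
  then have "\<alpha> * (\<mu> * inner a a) \<le> \<alpha> * inner a (p - q)"
    using assms(2) by (rule mult_left_mono)
  then show ?thesis
    by (simp add: *(2))
qed

lemma increments_lipschitz:
  assumes "lipschitz_op L A" "0 \<le> \<alpha>" "(a, v) \<in> increments \<alpha> A"
  shows "norm v \<le> \<alpha> * L * norm a"
proof -
  obtain x y p q where *: "a = x - y" "v = \<alpha> *\<^sub>R (p - q)" "(x, p) \<in> A" "(y, q) \<in> A"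
    using assms(3) by (auto simp: increments_def)
  have "norm (p - q) \<le> L * norm a"
    using assms(1) * by (auto simp: lipschitz_op_def)
  then have "\<alpha> * norm (p - q) \<le> \<alpha> * (L * norm a)"
    using assms(2) by (rule mult_left_mono)
  then show ?thesis
    using assms(2) by (simp add: *(2))
qed

text \<open>The operator \<alpha>C is cocoercive with constant \<beta>/\<alpha>, and the stepsize
  condition makes this at least 1/(2 \<theta>).\<close>

lemma increments_cocoercive:
  assumes "cocoercive_op \<beta> C" "0 < \<alpha>" "\<alpha> \<le> 2 * \<beta> * \<theta>" "0 \<le> \<theta>" "(b, c) \<in> increments \<alpha> C"
  shows "inner c c \<le> 2 * \<theta> * inner b c"
proof -
  obtain x y p q where *: "b = x - y" "c = \<alpha> *\<^sub>R (p - q)" "(x, p) \<in> C" "(y, q) \<in> C"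
    using assms(5) by (auto simp: increments_def)
  define g where "g = inner (p - q) (p - q)"
  have "\<beta> * g \<le> inner b (p - q)"
    using assms(1) * by (auto simp: cocoercive_op_def power2_norm_eq_inner g_def)
  then have "2 * \<theta> * (\<beta> * g) \<le> 2 * \<theta> * inner b (p - q)"
    using assms(4) by (intro mult_left_mono) auto
  moreover have "\<alpha> * g \<le> 2 * \<beta> * \<theta> * g"
    using assms(3) by (intro mult_right_mono) (auto simp: g_def)
  ultimately have "\<alpha> * g \<le> 2 * \<theta> * inner b (p - q)"
    by (simp add: ac_simps)
  then have "\<alpha> * (\<alpha> * g) \<le> \<alpha> * (2 * \<theta> * inner b (p - q))"
    using assms(2) by (intro mult_left_mono) auto
  then show ?thesis
    by (simp add: *(2) g_def algebra_simps)
qed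

text \<open>Subtracting two instances of \<open>davis_yin_step\<close> leaves linear relations
  between increments; the argument of the outer resolvent simplifies by 2b - z = b - u.\<close>

lemma davis_yin_increment:
  assumes "monotone_op B" "0 \<le> \<alpha>"
    and T: "(z, t) \<in> davis_yin A B C \<alpha> lam" "(z', t') \<in> davis_yin A B C \<alpha> lam"
  obtains a b c u v where "(b, u) \<in> increments \<alpha> B" "(b, c) \<in> increments \<alpha> C"
    "(a, v) \<in> increments \<alpha> A" "z - z' = b + u" "b - u - c = a + v"
    "t - t' = (z - z') - lam *\<^sub>R (b - a)"
proof -
  obtain b p c a q where 1: "(b, p) \<in> B" "(b, c) \<in> C" "(a, q) \<in> A"
    and z: "z = b + \<alpha> *\<^sub>R p" and w: "2 *\<^sub>R b - z - \<alpha> *\<^sub>R c = a + \<alpha> *\<^sub>R q"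
    and t: "t = z - lam *\<^sub>R b + lam *\<^sub>R a"
    using davis_yin_step[OF assms(1,2) T(1)] .
  obtain b' p' c' a' q' where 2: "(b', p') \<in> B" "(b', c') \<in> C" "(a', q') \<in> A"
    and z': "z' = b' + \<alpha> *\<^sub>R p'" and w': "2 *\<^sub>R b' - z' - \<alpha> *\<^sub>R c' = a' + \<alpha> *\<^sub>R q'"
    and t': "t' = z' - lam *\<^sub>R b' + lam *\<^sub>R a'"
    using davis_yin_step[OF assms(1,2) T(2)] .
  show ?thesis
  proof
    show "(b - b', \<alpha> *\<^sub>R (p - p')) \<in> increments \<alpha> B" "(b - b', \<alpha> *\<^sub>R (c - c')) \<in> increments \<alpha> C"
      "(a - a', \<alpha> *\<^sub>R (q - q')) \<in> increments \<alpha> A"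
      using 1 2 by (auto simp: increments_def)
    show zz: "z - z' = (b - b') + \<alpha> *\<^sub>R (p - p')"
      by (simp add: z z' algebra_simps)
    have "b - b' - \<alpha> *\<^sub>R (p - p') - \<alpha> *\<^sub>R (c - c')
        = (2 *\<^sub>R b - z - \<alpha> *\<^sub>R c) - (2 *\<^sub>R b' - z' - \<alpha> *\<^sub>R c')"
      by (simp add: z z' algebra_simps scaleR_2)
    also have "\<dots> = (a - a') + \<alpha> *\<^sub>R (q - q')"
      unfolding w w' by (simp add: algebra_simps)
    finally show "b - b' - \<alpha> *\<^sub>R (p - p') - \<alpha> *\<^sub>R (c - c') = (a - a') + \<alpha> *\<^sub>R (q - q')" .
    show "t - t' = (z - z') - lam *\<^sub>R ((b - b') - (a - a'))"
      by (simp add: t t' algebra_simps)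
  qed
qed

section \<open>From decrease to contraction\<close>

lemma norm_le_of_decrease:
  fixes z d :: "'a::real_inner"
  assumes "0 \<le> lam" "r * inner z z \<le> 2 * inner d z - lam * inner d d"
  shows "norm (z - lam *\<^sub>R d) \<le> sqrt (1 - lam * r) * norm z"
proof -
  have "inner (z - lam *\<^sub>R d) (z - lam *\<^sub>R d) = inner z z - lam * (2 * inner d z - lam * inner d d)"
    by (simp add: inner_diff_left inner_diff_right inner_commute algebra_simps)
  also have "\<dots> \<le> inner z z - lam * (r * inner z z)"
    using assms by (intro diff_left_mono mult_left_mono)
  also have "\<dots> = (1 - lam * r) * inner z z"
    by (simp add: algebra_simps)
  finally show ?thesis
    \<comment> \<open>Here \<open>sqrt\<close> is monotone and multiplicative on all reals, so the
      sign of 1 - lam * r does not matter.\<close>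
    by (simp add: norm_eq_sqrt_inner flip: real_sqrt_mult)
qed

text \<open>Single-valuedness is the estimate at x = y.\<close>

lemma contractive_opI:
  assumes "\<And>x u y v. (x, u) \<in> T \<Longrightarrow> (y, v) \<in> T \<Longrightarrow> norm (u - v) \<le> \<rho> * norm (x - y)"
  shows "contractive_op \<rho> T"
proof -
  have "u = v" if "(x, u) \<in> T" "(x, v) \<in> T" for x u v
    using assms[OF that] by simp
  then show ?thesis
    using assms by (auto simp: contractive_op_def single_valued_def)
qed

text \<open>Put \<theta> = 2 - lam, m = 2 \<alpha> \<mu> and l = \<alpha> L. Clearing the
  denominator \<theta> + m of q turns each term of \<open>rate\<close> into the stated fraction, and
  the positive factor \<open>lam\<close> passes through the minimum.\<close>

lemma rate_formula:
  fixes \<alpha> \<mu> L lam :: real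
  assumes "0 < \<alpha>" "0 < \<mu>" "0 < L" "0 < lam" "lam < 2"
  shows "min (2 * \<alpha> * \<mu> * lam * (2 - lam) / ((1 + \<alpha>\<^sup>2 * L\<^sup>2) * (2 - lam + 2 * \<alpha> * \<mu>)))
      (2 * \<alpha> * lam * ((2 - lam) * (\<mu> + L) + 2 * \<alpha> * \<mu> * L) / ((1 + \<alpha> * L)\<^sup>2 * (2 - lam + 2 * \<alpha> * \<mu>)))
    = lam * rate (half_harmonic (2 - lam) (2 * \<alpha> * \<mu>)) (\<alpha> * L)"
proof -
  define s where "s = 2 - lam + 2 * \<alpha> * \<mu>"
  have "0 < 2 * \<alpha> * \<mu>"
    using assms by simp
  then have s: "s \<noteq> 0"
    using assms(5) unfolding s_def by linarith
  have h: "half_harmonic (2 - lam) (2 * \<alpha> * \<mu>) = (2 - lam) * (2 * \<alpha> * \<mu>) / s"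
    by (simp add: half_harmonic_def s_def)
  have 1: "2 * \<alpha> * \<mu> * lam * (2 - lam) / ((1 + \<alpha>\<^sup>2 * L\<^sup>2) * s)
      = lam * ((2 - lam) * (2 * \<alpha> * \<mu>) / s / (1 + (\<alpha> * L)\<^sup>2))"
    by (simp add: power_mult_distrib ac_simps)
  have "lam * ((2 - lam) * (2 * \<alpha> * \<mu>) / s + 2 * (\<alpha> * L))
      = lam * ((2 - lam) * (2 * \<alpha> * \<mu>) + 2 * (\<alpha> * L) * s) / s"
    using s by (simp add: field_simps)
  also have "lam * ((2 - lam) * (2 * \<alpha> * \<mu>) + 2 * (\<alpha> * L) * s)
      = 2 * \<alpha> * lam * ((2 - lam) * (\<mu> + L) + 2 * \<alpha> * \<mu> * L)"
    by (simp add: s_def algebra_simps)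
  finally have 2: "2 * \<alpha> * lam * ((2 - lam) * (\<mu> + L) + 2 * \<alpha> * \<mu> * L) / ((1 + \<alpha> * L)\<^sup>2 * s)
      = lam * (((2 - lam) * (2 * \<alpha> * \<mu>) / s + 2 * (\<alpha> * L)) / (1 + \<alpha> * L)\<^sup>2)"
    by (simp add: ac_simps)
  show ?thesis
    unfolding s_def[symmetric] 1 2 rate_def h using assms(4)
    by (simp only: min_mult_distrib_left if_True less_imp_le)
qed

theorem theorem3p2:
  fixes A B C :: "'a::{real_inner, complete_space} multiop"
    and \<alpha> \<beta> lam :: real
  assumes "0 < \<alpha>" and "\<alpha> < 4 * \<beta>"
    and "0 < lam" and "lam < 2 - \<alpha> / (2 * \<beta>)"
    and "monotone_op A" and "monotone_op B" and "cocoercive_op \<beta> C"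
  shows
    "(\<forall>L\<^sub>A \<mu>\<^sub>B :: real. 0 < L\<^sub>A \<longrightarrow> 0 < \<mu>\<^sub>B \<longrightarrow>
        lipschitz_op L\<^sub>A A \<longrightarrow> strongly_monotone_op \<mu>\<^sub>B B \<longrightarrow>
        contractive_op
          (sqrt (1 - min
            (2 * \<alpha> * \<mu>\<^sub>B * lam * (2 - lam) /
              ((1 + \<alpha>\<^sup>2 * L\<^sub>A\<^sup>2) * (2 - lam + 2 * \<alpha> * \<mu>\<^sub>B)))
            (2 * \<alpha> * lam * ((2 - lam) * (\<mu>\<^sub>B + L\<^sub>A) + 2 * \<alpha> * \<mu>\<^sub>B * L\<^sub>A) /
              ((1 + \<alpha> * L\<^sub>A)\<^sup>2 * (2 - lam + 2 * \<alpha> * \<mu>\<^sub>B)))))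
          (davis_yin A B C \<alpha> lam)) \<and>
     (\<forall>\<mu>\<^sub>A L\<^sub>B :: real. 0 < \<mu>\<^sub>A \<longrightarrow> 0 < L\<^sub>B \<longrightarrow>
        strongly_monotone_op \<mu>\<^sub>A A \<longrightarrow> lipschitz_op L\<^sub>B B \<longrightarrow>
        contractive_op
          (sqrt (1 - min
            (2 * \<alpha> * \<mu>\<^sub>A * lam * (2 - lam) /
              ((1 + \<alpha>\<^sup>2 * L\<^sub>B\<^sup>2) * (2 - lam + 2 * \<alpha> * \<mu>\<^sub>A)))
            (2 * \<alpha> * lam * ((2 - lam) * (\<mu>\<^sub>A + L\<^sub>B) + 2 * \<alpha> * \<mu>\<^sub>A * L\<^sub>B) /
              ((1 + \<alpha> * L\<^sub>B)\<^sup>2 * (2 - lam + 2 * \<alpha> * \<mu>\<^sub>A)))))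
          (davis_yin A B C \<alpha> lam))"
proof -
  have \<beta>: "0 < \<beta>"
    using assms(1,2) by linarith
  then have "0 < \<alpha> / (2 * \<beta>)"
    using assms(1) by simp
  then have lam2: "lam < 2"
    using assms(4) by linarith
  define \<theta> where "\<theta> = 2 - lam"
  have \<theta>: "0 < \<theta>" "\<theta> \<le> 2" "lam = 2 - \<theta>"
    using assms(3) lam2 by (auto simp: \<theta>_def)
  have "\<alpha> / (2 * \<beta>) \<le> \<theta>"
    using assms(4) by (simp add: \<theta>_def)
  \<comment> \<open>The upper bound on \<open>lam\<close> in the form that
    \<open>increments_cocoercive\<close> expects.\<close>
  then have \<alpha>\<theta>: "\<alpha> \<le> 2 * \<beta> * \<theta>"
    using \<beta> by (simp add: field_simps)
  have \<alpha>: "0 \<le> \<alpha>"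
    using assms(1) by simp
  note coco = increments_cocoercive[OF assms(7,1) \<alpha>\<theta> less_imp_le[OF \<theta>(1)]]
  show ?thesis
  proof (intro conjI allI impI)
    fix L \<mu> :: real
    assume L: "0 < L" and \<mu>: "0 < \<mu>" and A: "lipschitz_op L A" and B: "strongly_monotone_op \<mu> B"
    have pos: "0 < 2 * \<alpha> * \<mu>" "0 < \<alpha> * L"
      using L \<mu> assms(1) by simp_all
    show "contractive_op (sqrt (1 - min
            (2 * \<alpha> * \<mu> * lam * (2 - lam) / ((1 + \<alpha>\<^sup>2 * L\<^sup>2) * (2 - lam + 2 * \<alpha> * \<mu>)))
            (2 * \<alpha> * lam * ((2 - lam) * (\<mu> + L) + 2 * \<alpha> * \<mu> * L) /
              ((1 + \<alpha> * L)\<^sup>2 * (2 - lam + 2 * \<alpha> * \<mu>))))) (davis_yin A B C \<alpha> lam)"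
      unfolding rate_formula[OF assms(1) \<mu> L assms(3) lam2]
    proof (rule contractive_opI)
      fix z t z' t'
      assume T: "(z, t) \<in> davis_yin A B C \<alpha> lam" "(z', t') \<in> davis_yin A B C \<alpha> lam"
      obtain a b c u v where inc: "(b, u) \<in> increments \<alpha> B" "(b, c) \<in> increments \<alpha> C"
          "(a, v) \<in> increments \<alpha> A"
        and z: "z - z' = b + u" and w: "b - u - c = a + v"
        and t: "t - t' = (z - z') - lam *\<^sub>R (b - a)"
        using davis_yin_increment[OF assms(6) \<alpha> T] .
      \<comment> \<open>Strong monotonicity of B, with 2 |b|^2 added to both sides so that u is
        absorbed into z = b + u.\<close>
      have "(2 + 2 * \<alpha> * \<mu>) * inner b b \<le> 2 * inner b (b + u)"
        using increments_strongly_monotone[OF B \<alpha> inc(1)] by (simp add: inner_add_right algebra_simps)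
      moreover have "2 *\<^sub>R b - (b + u) - c = a + v"
        using w by (simp add: scaleR_2)
      ultimately show "norm (t - t')
          \<le> sqrt (1 - lam * rate (half_harmonic (2 - lam) (2 * \<alpha> * \<mu>)) (\<alpha> * L)) * norm (z - z')"
        using decrease_rate_B[where z = "b + u", OF \<theta>(1) pos(1) \<theta>(2) pos(2) _ coco[OF inc(2)] _
            increments_monotone[OF assms(5) \<alpha> inc(3)] increments_lipschitz[OF A \<alpha> inc(3)]]
          norm_le_of_decrease[OF less_imp_le[OF assms(3)]]
        by (simp add: t z \<theta>_def)
    qed
  next
    fix \<mu> L :: real
    assume \<mu>: "0 < \<mu>" and L: "0 < L" and A: "strongly_monotone_op \<mu> A" and B: "lipschitz_op L B"
    have pos: "0 < 2 * \<alpha> * \<mu>" "0 < \<alpha> * L"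
      using L \<mu> assms(1) by simp_all
    show "contractive_op (sqrt (1 - min
            (2 * \<alpha> * \<mu> * lam * (2 - lam) / ((1 + \<alpha>\<^sup>2 * L\<^sup>2) * (2 - lam + 2 * \<alpha> * \<mu>)))
            (2 * \<alpha> * lam * ((2 - lam) * (\<mu> + L) + 2 * \<alpha> * \<mu> * L) /
              ((1 + \<alpha> * L)\<^sup>2 * (2 - lam + 2 * \<alpha> * \<mu>))))) (davis_yin A B C \<alpha> lam)"
      unfolding rate_formula[OF assms(1) \<mu> L assms(3) lam2]
    proof (rule contractive_opI)
      fix z t z' t'
      assume T: "(z, t) \<in> davis_yin A B C \<alpha> lam" "(z', t') \<in> davis_yin A B C \<alpha> lam"
      obtain a b c u v where inc: "(b, u) \<in> increments \<alpha> B" "(b, c) \<in> increments \<alpha> C"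
          "(a, v) \<in> increments \<alpha> A"
        and z: "z - z' = b + u" and w: "b - u - c = a + v"
        and t: "t - t' = (z - z') - lam *\<^sub>R (b - a)"
        using davis_yin_increment[OF assms(6) \<alpha> T] .
      show "norm (t - t')
          \<le> sqrt (1 - lam * rate (half_harmonic (2 - lam) (2 * \<alpha> * \<mu>)) (\<alpha> * L)) * norm (z - z')"
        using decrease_rate_A[OF \<theta>(1) pos increments_strongly_monotone[OF A \<alpha> inc(3)]
            coco[OF inc(2)] w increments_monotone[OF assms(6) \<alpha> inc(1)]
            increments_lipschitz[OF B \<alpha> inc(1)]]
          norm_le_of_decrease[OF less_imp_le[OF assms(3)]]
        by (simp add: t z \<theta>_def)
    qed
  qed
qed

end
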